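(* Consider the $(n_0,n_1,\ldots,n_N)$ multihop channel in the clustered case. The cooperative decode-and-forward scheme achieves the DMT cut-set bound, i.e. its DMT is $$\bar d(r)=\min_{i=1,\ldots,N} d_i(r),$$ where $d_i(r)$ is the DMT of the point-to-point Rayleigh MIMO channel between layer $i-1$ and layer $i$.
   Context: Multihop channel: layers $0,1,\ldots,N$ (source = layer $0$, destination = layer $N$, relays in layers $1,\ldots,N-1$), with $n_i$ antennas in layer $i$; $\mathbf y_i=\mathbf H_i\mathbf x_{i-1}+\mathbf z_i$, $i=1,\ldots,N$, where $\mathbf H_i\in\mathbb C^{n_i\times n_{i-1}}$ are mutually independent with i.i.d. $\mathcal{CN}(0,1)$ entries, constant during the (long) coherence interval, and $\mathbf z_i$ has i.i.d. $\mathcal{CN}(0,1)$ entries. Power constraint $\mathbb E\|\mathbf x_i\|^2\le\mathsf{SNR}$ for every $i$; receivers know the channel, transmitters do not. Clustered case: relays within the same layer can perform joint decoding and joint re-encoding, so each layer acts as one multi-antenna terminal. Cooperative decode-and-forward (DF): each layer jointly decodes the received signal; upon successful decoding the message is re-encoded and forwarded to the next layer. The scheme can be in outage at rate $R$ only if at least one of the $N$ sub-channels is in outage at rate $R$, the $i$-th sub-channel being in outage when $I(\mathbf x_{i-1};\mathbf y_i\mid\mathbf H_i)<R$. DMT: a channel (or scheme) with outage probability $P_{\rm out}(\mathsf{SNR},R)$ has DMT $d(r)=-\lim_{\mathsf{SNR}\to\infty}\log P_{\rm out}(\mathsf{SNR},R)/\log\mathsf{SNR}$, where $R=r\log\mathsf{SNR}$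 for $r>0$, and $R>0$ is a fixed rate for $r=0$. For any relaying strategy the end-to-end mutual information satisfies $I(\mathbf x_0;\mathbf y_N\mid\mathbf H_1,\ldots,\mathbf H_N)\le I(\mathbf x_{i-1};\mathbf y_i\mid\mathbf H_i)$ for all $i$ (information-theoretic cut-set bound). *)

theory Defs
  imports "HOL-Probability.Probability"
begin

section \<open>Rayleigh MIMO channels\<close>

text \<open>Vectors of length \<open>n\<close> are extensional functions on \<open>{..<n}\<close> and matrices are extensional
  functions on index pairs (row, column), because the dimension varies from layer to layer.\<close>

definition cvec :: "nat \<Rightarrow> (nat \<Rightarrow> complex) measure" where
  "cvec n = PiM {..<n} (\<lambda>_. borel)"

text \<open>The circularly symmetric law \<open>CN(0,1)\<close>: real and imaginary part have variance 1/2 each.\<close>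

definition cn01 :: "complex measure" where
  "cn01 = density lborel (\<lambda>z. ennreal (exp (- (cmod z)\<^sup>2) / pi))"

definition noise :: "nat \<Rightarrow> (nat \<Rightarrow> complex) measure" where
  "noise n = PiM {..<n} (\<lambda>_. cn01)"

definition rayleigh :: "nat \<Rightarrow> nat \<Rightarrow> (nat \<times> nat \<Rightarrow> complex) measure" where
  "rayleigh nt nr = PiM ({..<nr} \<times> {..<nt}) (\<lambda>_. cn01)"

definition received ::
  "nat \<Rightarrow> nat \<Rightarrow> (nat \<times> nat \<Rightarrow> complex) \<Rightarrow> (nat \<Rightarrow> complex) \<Rightarrow> (nat \<Rightarrow> complex) \<Rightarrow> nat \<Rightarrow> complex" where
  "received nt nr H x z = (\<lambda>k\<in>{..<nr}. (\<Sum>l<nt. H (k, l) * x l) + z k)"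

text \<open>Laws of a transmitted vector obeying the power constraint; they need not be Gaussian.\<close>

definition input_laws :: "nat \<Rightarrow> real \<Rightarrow> (nat \<Rightarrow> complex) measure set" where
  "input_laws n SNR = {\<mu>. prob_space \<mu> \<and> sets \<mu> = sets (cvec n) \<and>
     (\<integral>\<^sup>+x. ennreal (\<Sum>l<n. (cmod (x l))\<^sup>2) \<partial>\<mu>) \<le> ennreal SNR}"

text \<open>The mutual information, in bits, between the input and the output of the channel with
  realization \<open>H\<close>. The library's \<open>mutual_information\<close> is a Bochner integral, which is 0 by
  convention when the integrand is not integrable; this case does not arise for inputs of finite
  power.\<close>

definition mimo_information ::
  "nat \<Rightarrow> nat \<Rightarrow> (nat \<Rightarrow> complex) measure \<Rightarrow> (nat \<times> nat \<Rightarrow> complex) \<Rightarrow> real" where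
  "mimo_information nt nr \<mu> H =
     prob_space.mutual_information (\<mu> \<Otimes>\<^sub>M noise nr) 2 (cvec nt) (cvec nr)
       fst (\<lambda>(x, z). received nt nr H x z)"

definition channel_outage ::
  "nat \<Rightarrow> nat \<Rightarrow> (nat \<Rightarrow> complex) measure \<Rightarrow> (nat \<times> nat \<Rightarrow> complex) \<Rightarrow> real \<Rightarrow> bool" where
  "channel_outage nt nr \<mu> H R \<longleftrightarrow> mimo_information nt nr \<mu> H < R"

text \<open>The input law may depend on \<open>SNR\<close> and \<open>R\<close>, but not on \<open>H\<close>, which the transmitter does not know.\<close>

definition p2p_outage_prob :: "nat \<Rightarrow> nat \<Rightarrow> real \<Rightarrow> real \<Rightarrow> real" where
  "p2p_outage_prob nt nr SNR R =
     (INF \<mu>\<in>input_laws nt SNR.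
        measure (rayleigh nt nr) {H \<in> space (rayleigh nt nr). channel_outage nt nr \<mu> H R})"


section \<open>Diversity-multiplexing tradeoff\<close>

text \<open>Here \<open>log 0\<close> is read as minus infinity, unlike the library's \<open>log 2 0 = 0\<close>.\<close>

definition outage_exponent :: "real \<Rightarrow> real \<Rightarrow> ereal" where
  "outage_exponent p SNR = (if p = 0 then \<infinity> else ereal (- log 2 p / log 2 SNR))"

definition has_dmt :: "(real \<Rightarrow> real \<Rightarrow> real) \<Rightarrow> real \<Rightarrow> ereal \<Rightarrow> bool" where
  "has_dmt Pout r d \<longleftrightarrow>
     (if r = 0
      then \<forall>R>0. ((\<lambda>SNR. outage_exponent (Pout SNR R) SNR) \<longlongrightarrow> d) at_top
      else ((\<lambda>SNR. outage_exponent (Pout SNR (r * log 2 SNR)) SNR) \<longlongrightarrow> d) at_top)"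


section \<open>The clustered multihop channel\<close>

text \<open>Hop \<open>i\<close>, for \<open>1 \<le> i \<le> N\<close>, leads from layer \<open>i - 1\<close> to layer \<open>i\<close> and has the matrix \<open>H i\<close>.\<close>

definition multihop :: "(nat \<Rightarrow> nat) \<Rightarrow> nat \<Rightarrow> (nat \<Rightarrow> nat \<times> nat \<Rightarrow> complex) measure" where
  "multihop n N = PiM {1..N} (\<lambda>i. rayleigh (n (i - 1)) (n i))"

text \<open>Cooperative decode-and-forward: a relay layer transmits only after it has decoded, so a layer
  decodes iff the preceding one does and the hop in between is not in outage. The law \<open>X i\<close> is
  that of the codebook of layer \<open>i\<close>.\<close>

fun df_decodes :: "(nat \<Rightarrow> nat) \<Rightarrow> (nat \<Rightarrow> (nat \<Rightarrow> complex) measure) \<Rightarrow>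
    (nat \<Rightarrow> nat \<times> nat \<Rightarrow> complex) \<Rightarrow> real \<Rightarrow> nat \<Rightarrow> bool" where
  "df_decodes n X H R 0 \<longleftrightarrow> True"
| "df_decodes n X H R (Suc i) \<longleftrightarrow>
     df_decodes n X H R i \<and> \<not> channel_outage (n i) (n (Suc i)) (X i) (H (Suc i)) R"

definition df_outage_prob :: "(nat \<Rightarrow> nat) \<Rightarrow> nat \<Rightarrow> real \<Rightarrow> real \<Rightarrow> real" where
  "df_outage_prob n N SNR R =
     (INF X\<in>(\<Pi> i\<in>{..<N}. input_laws (n i) SNR).
        measure (multihop n N) {H \<in> space (multihop n N). \<not> df_decodes n X H R N})"

text \<open>An arbitrary relaying strategy, described by the law \<open>X i H\<close> of the vector sent by layer
  \<open>i\<close> when the channel realization is \<open>H\<close> (a layer can only exploit the hops up to its own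
  receiver), and by its end-to-end mutual information \<open>J H\<close>. Besides causality and the power
  constraint, the only property required is the information-theoretic cut-set inequality, which
  every strategy satisfies.\<close>

definition relaying_strategy :: "(nat \<Rightarrow> nat) \<Rightarrow> nat \<Rightarrow> real \<Rightarrow>
    (nat \<Rightarrow> (nat \<Rightarrow> nat \<times> nat \<Rightarrow> complex) \<Rightarrow> (nat \<Rightarrow> complex) measure) \<Rightarrow>
    ((nat \<Rightarrow> nat \<times> nat \<Rightarrow> complex) \<Rightarrow> real) \<Rightarrow> bool" where
  "relaying_strategy n N SNR X J \<longleftrightarrow>
     (\<forall>i<N. \<forall>H\<in>space (multihop n N). X i H \<in> input_laws (n i) SNR) \<and>
     (\<forall>i<N. \<forall>H\<in>space (multihop n N). \<forall>H'\<in>space (multihop n N).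
        (\<forall>j\<in>{1..i}. H j = H' j) \<longrightarrow> X i H = X i H') \<and>
     J \<in> borel_measurable (multihop n N) \<and>
     (\<forall>H\<in>space (multihop n N). \<forall>i\<in>{1..N}.
        J H \<le> mimo_information (n (i - 1)) (n i) (X (i - 1) H) (H i))"

definition strategy_outage_prob ::
  "(nat \<Rightarrow> nat) \<Rightarrow> nat \<Rightarrow> ((nat \<Rightarrow> nat \<times> nat \<Rightarrow> complex) \<Rightarrow> real) \<Rightarrow> real \<Rightarrow> real" where
  "strategy_outage_prob n N J R =
     measure (multihop n N) {H \<in> space (multihop n N). J H < R}"

end

theory Submission
  imports Defs "HOL-Real_Asymp.Real_Asymp"
begin

text \<open>Decode-and-forward fails iff some hop is in outage, and the input laws of the hops can be chosen
  independently of each other, so its outage probability lies between the largest and the sum of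
  the \<open>N\<close> point-to-point outage probabilities; the factor \<open>N\<close> is invisible on the scale of
  \<open>log SNR\<close>. Conversely, an arbitrary strategy is in outage whenever some hop is, and conditioning
  on all the other hops reduces this to an outage event of a single hop with a fixed input law.
  Both directions need outage events to be measurable in the channel matrix, since \<open>measure\<close> is 0
  on non-measurable sets; this follows from an explicit integral formula for the mutual
  information.\<close>

section \<open>The Gaussian channel density\<close>

definition cn01_density :: "complex \<Rightarrow> real" where
  "cn01_density z = exp (- (cmod z)\<^sup>2) / pi"

definition lborel_vec :: "nat \<Rightarrow> (nat \<Rightarrow> complex) measure" where
  "lborel_vec n = PiM {..<n} (\<lambda>_. lborel)"

definition noise_density :: "nat \<Rightarrow> (nat \<Rightarrow> complex) \<Rightarrow> real" where
  "noise_density n z = (\<Prod>k<n. cn01_density (z k))"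

lemma cn01_density_measurable [measurable]: "cn01_density \<in> borel_measurable borel"
  unfolding cn01_density_def[abs_def] by measurable

lemma cn01_density_pos: "0 < cn01_density z"
  by (simp add: cn01_density_def)

lemma cn01_density_le_1: "cn01_density z \<le> 1"
proof -
  have "exp (- (cmod z)\<^sup>2) \<le> 1" by simp
  also have "1 \<le> pi" using pi_ge_two by linarith
  finally show ?thesis by (simp add: cn01_density_def)
qed

lemma cn01_eq: "cn01 = density lborel (\<lambda>z. ennreal (cn01_density z))"
  by (simp add: cn01_def cn01_density_def)

lemma sets_cn01 [measurable_cong, simp]: "sets cn01 = sets borel"
  by (simp add: cn01_def)

lemma space_cn01 [simp]: "space cn01 = UNIV"
  by (simp add: cn01_def)

text \<open>Since |z|^2 = Re(z)^2 + Im(z)^2, the circular Gaussian is a pair of independent real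
  Gaussians of variance 1/2, which reduces its normalization to that of
  \<open>normal_density\<close>.\<close>

lemma cn01_density_eq_prod:
  "cn01_density z = (\<Prod>b\<in>Basis. normal_density 0 (1 / sqrt 2) (z \<bullet> b))"
proof -
  have *: "normal_density 0 (1 / sqrt 2) t = exp (- t\<^sup>2) / sqrt pi" for t :: real
    by (simp add: normal_density_def power_divide)
  have "exp (- (cmod z)\<^sup>2) = exp (- (Re z)\<^sup>2) * exp (- (Im z)\<^sup>2)"
    by (simp add: cmod_power2 exp_add[symmetric])
  moreover have "sqrt pi * sqrt pi = pi" by simp
  ultimately show ?thesis
    unfolding cn01_density_def * by (simp add: Basis_complex_def inner_complex_def)
qed

lemma prob_space_cn01: "prob_space cn01"
proof
  have "emeasure cn01 (space cn01) = (\<integral>\<^sup>+z. ennreal (cn01_density z) \<partial>lborel)"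
    by (simp add: cn01_eq emeasure_density)
  also have "\<dots> = (\<integral>\<^sup>+(z::complex). (\<Prod>b\<in>Basis. ennreal (normal_density 0 (1 / sqrt 2) (z \<bullet> b))) \<partial>lborel)"
    by (simp add: cn01_density_eq_prod prod_ennreal)
  also have "\<dots> = (\<Prod>b\<in>(Basis :: complex set). \<integral>\<^sup>+t. ennreal (normal_density 0 (1 / sqrt 2) t) \<partial>lborel)"
    by (rule nn_integral_lborel_prod) auto
  also have "\<dots> = 1"
    by (subst nn_integral_eq_integral) auto
  finally show "emeasure cn01 (space cn01) = 1" .
qed

text \<open>Lebesgue measure is translation invariant, so the shift moves into the density.\<close>

lemma distr_plus_cn01:
  "distr cn01 borel (\<lambda>z. c + z) = density lborel (\<lambda>y. ennreal (cn01_density (y - c)))"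
proof -
  have "density lborel (\<lambda>y. ennreal (cn01_density (y - c)))
      = density (distr lborel borel ((+) c)) (\<lambda>y. ennreal (cn01_density (y - c)))"
    by (simp add: lborel_distr_plus)
  also have "\<dots> = distr (density lborel (\<lambda>z. ennreal (cn01_density (c + z - c)))) borel ((+) c)"
    by (rule density_distr) auto
  finally show ?thesis by (simp add: cn01_eq)
qed

lemma prob_space_noise: "prob_space (noise n)"
  unfolding noise_def by (intro prob_space_PiM prob_space_cn01)

lemma prob_space_rayleigh: "prob_space (rayleigh nt nr)"
  unfolding rayleigh_def by (intro prob_space_PiM prob_space_cn01)

lemma sets_noise: "sets (noise n) = sets (cvec n)"
  unfolding noise_def cvec_def by (intro sets_PiM_cong) auto

lemma sets_lborel_vec: "sets (lborel_vec n) = sets (cvec n)"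
  unfolding lborel_vec_def cvec_def by (intro sets_PiM_cong) auto

lemma sigma_finite_lborel_vec: "sigma_finite_measure (lborel_vec n)"
proof -
  interpret product_sigma_finite "\<lambda>_::nat. lborel :: complex measure" ..
  show ?thesis unfolding lborel_vec_def by (rule sigma_finite) simp
qed

lemma measurable_cvec_component:
  "f \<in> M \<rightarrow>\<^sub>M cvec n \<Longrightarrow> k < n \<Longrightarrow> (\<lambda>\<omega>. f \<omega> k) \<in> borel_measurable M"
  unfolding cvec_def by (rule measurable_compose[OF _ measurable_component_singleton]) auto

lemma noise_density_pos: "0 < noise_density n z"
  unfolding noise_density_def by (intro prod_pos ballI cn01_density_pos)

lemma noise_density_le_1: "noise_density n z \<le> 1"
  unfolding noise_density_def by (intro prod_le_1 conjI cn01_density_le_1 less_imp_le cn01_density_pos)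

text \<open>With \<open>c\<close> the noiseless signal H x, this is the law of the output given the
  input. Both sides equal the product of the shifted one-dimensional laws, since all three agree on
  boxes.\<close>

lemma distr_translate_noise:
  "distr (noise n) (cvec n) (\<lambda>z. \<lambda>k\<in>{..<n}. c k + z k)
     = density (lborel_vec n) (\<lambda>y. ennreal (noise_density n (\<lambda>k. y k - c k)))"
    (is "?D = ?E")
proof -
  define M where "M k = density lborel (\<lambda>y. ennreal (cn01_density (y - c k)))" for k
  have M: "distr cn01 borel (\<lambda>z. c k + z) = M k" for k
    by (simp add: M_def distr_plus_cn01)
  have pM: "prob_space (M k)" for k
    unfolding M[symmetric] by (intro prob_space.prob_space_distr prob_space_cn01) measurable
  have sM [simp]: "sets (M k) = sets borel" for k
    by (simp add: M_def)
  interpret M: product_prob_space M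
    by (intro product_prob_spaceI pM)
  interpret N: product_prob_space "\<lambda>_::nat. cn01"
    by (intro product_prob_spaceI prob_space_cn01)
  interpret L: product_sigma_finite "\<lambda>_::nat. lborel :: complex measure" ..
  have setsM: "sets (PiM {..<n} M) = sets (cvec n)"
    unfolding cvec_def by (intro sets_PiM_cong) auto
  have "?D = PiM {..<n} M"
  proof (rule M.PiM_eqI)
    fix A assume A: "\<And>i. i \<in> {..<n} \<Longrightarrow> A i \<in> sets (M i)"
    have [measurable]: "(\<lambda>z. \<lambda>k\<in>{..<n}. c k + z k) \<in> noise n \<rightarrow>\<^sub>M cvec n"
      unfolding cvec_def noise_def by measurable
    have "Pi\<^sub>E {..<n} A \<in> sets (cvec n)"
      unfolding cvec_def using A by (intro sets_PiM_I_finite) auto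
    then have "?D (Pi\<^sub>E {..<n} A)
        = noise n ((\<lambda>z. \<lambda>k\<in>{..<n}. c k + z k) -` Pi\<^sub>E {..<n} A \<inter> space (noise n))"
      by (intro emeasure_distr) auto
    \<comment> \<open>The preimage of a box is a box, so independence of the noise coordinates
      applies.\<close>
    also have "(\<lambda>z. \<lambda>k\<in>{..<n}. c k + z k) -` Pi\<^sub>E {..<n} A \<inter> space (noise n)
        = (\<Pi>\<^sub>E k\<in>{..<n}. (\<lambda>z. c k + z) -` A k)"
      by (auto simp: noise_def space_PiM PiE_def Pi_def extensional_def)
    also have "noise n \<dots> = (\<Prod>k<n. cn01 ((\<lambda>z. c k + z) -` A k))"
      unfolding noise_def
    proof (rule N.emeasure_PiM)
      fix k assume "k \<in> {..<n}"
      then have "A k \<in> sets borel" using A by auto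
      then have "(\<lambda>z. c k + z) -` A k \<inter> space borel \<in> sets borel"
        by (intro measurable_sets[of _ borel borel]) auto
      then show "(\<lambda>z. c k + z) -` A k \<in> sets cn01" by simp
    qed simp
    also have "\<dots> = (\<Prod>k<n. M k (A k))"
    proof (rule prod.cong[OF refl])
      fix k assume "k \<in> {..<n}"
      then show "cn01 ((\<lambda>z. c k + z) -` A k) = M k (A k)"
        unfolding M[symmetric] using A[of k] by (subst emeasure_distr) auto
    qed
    finally show "?D (Pi\<^sub>E {..<n} A) = (\<Prod>k<n. M k (A k))" .
  qed (auto simp: setsM)
  moreover have "?E = PiM {..<n} M"
  proof (rule M.PiM_eqI)
    fix A assume A: "\<And>i. i \<in> {..<n} \<Longrightarrow> A i \<in> sets (M i)"
    have [measurable]: "(\<lambda>y. ennreal (noise_density n (\<lambda>k. y k - c k))) \<in> borel_measurable (lborel_vec n)"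
      unfolding noise_density_def lborel_vec_def by measurable
    have "Pi\<^sub>E {..<n} A \<in> sets (lborel_vec n)"
      unfolding lborel_vec_def using A by (intro sets_PiM_I_finite) auto
    then have "?E (Pi\<^sub>E {..<n} A)
        = (\<integral>\<^sup>+y. ennreal (noise_density n (\<lambda>k. y k - c k)) * indicator (Pi\<^sub>E {..<n} A) y \<partial>lborel_vec n)"
      by (intro emeasure_density) auto
    also have "\<dots> = (\<integral>\<^sup>+y. (\<Prod>k<n. ennreal (cn01_density (y k - c k)) * indicator (A k) (y k)) \<partial>lborel_vec n)"
    proof (rule nn_integral_cong)
      fix y assume "y \<in> space (lborel_vec n)"
      \<comment> \<open>Vectors are extensional, so membership in the box is decided by the
        coordinates below \<open>n\<close> alone.\<close>
      then have "y \<in> extensional {..<n}"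
        by (simp add: lborel_vec_def space_PiM PiE_def)
      then have "indicator (Pi\<^sub>E {..<n} A) y = (\<Prod>k<n. indicator (A k) (y k) :: ennreal)"
        by (auto simp: indicator_def PiE_def Pi_def intro!: prod.neutral[symmetric])
      then show "ennreal (noise_density n (\<lambda>k. y k - c k)) * indicator (Pi\<^sub>E {..<n} A) y
          = (\<Prod>k<n. ennreal (cn01_density (y k - c k)) * indicator (A k) (y k))"
        by (simp add: noise_density_def prod.distrib prod_ennreal cn01_density_pos less_imp_le)
    qed
    also have "\<dots> = (\<Prod>k<n. \<integral>\<^sup>+t. ennreal (cn01_density (t - c k)) * indicator (A k) t \<partial>lborel)"
      unfolding lborel_vec_def using A by (intro L.product_nn_integral_prod) auto
    also have "\<dots> = (\<Prod>k<n. M k (A k))"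
      unfolding M_def using A by (intro prod.cong refl emeasure_density[symmetric]) auto
    finally show "?E (Pi\<^sub>E {..<n} A) = (\<Prod>k<n. M k (A k))" .
  qed (auto simp: setsM sets_lborel_vec)
  ultimately show ?thesis by simp
qed


section \<open>Measurability of the mutual information\<close>

text \<open>With the input law itself as reference measure the joint law of input and output has the
  density \<open>p(y | x)\<close>, so the mutual information is the integral of
  \<open>p(y | x) log\<^sub>2 (p(y | x) / p(y))\<close>, jointly measurable in the channel matrix.\<close>

definition transition_density ::
  "nat \<Rightarrow> nat \<Rightarrow> (nat \<times> nat \<Rightarrow> complex) \<Rightarrow> (nat \<Rightarrow> complex) \<Rightarrow> (nat \<Rightarrow> complex) \<Rightarrow> real" where
  "transition_density nt nr H x y = noise_density nr (\<lambda>k. y k - (\<Sum>l<nt. H (k, l) * x l))"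

definition output_density ::
  "nat \<Rightarrow> nat \<Rightarrow> (nat \<Rightarrow> complex) measure \<Rightarrow> (nat \<times> nat \<Rightarrow> complex) \<Rightarrow> (nat \<Rightarrow> complex) \<Rightarrow> real" where
  "output_density nt nr \<mu> H y = (\<integral>x. transition_density nt nr H x y \<partial>\<mu>)"

lemma measurable_rayleigh_component:
  "f \<in> M \<rightarrow>\<^sub>M rayleigh nt nr \<Longrightarrow> k < nr \<Longrightarrow> l < nt \<Longrightarrow> (\<lambda>\<omega>. f \<omega> (k, l)) \<in> borel_measurable M"
proof -
  assume f: "f \<in> M \<rightarrow>\<^sub>M rayleigh nt nr" and kl: "k < nr" "l < nt"
  have "(\<lambda>H. H (k, l)) \<in> rayleigh nt nr \<rightarrow>\<^sub>M cn01"
    unfolding rayleigh_def using kl by (intro measurable_component_singleton) auto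
  from measurable_compose[OF f this] show ?thesis
    using measurable_cong_sets[OF refl sets_cn01] by blast
qed

text \<open>Measurability of \<open>H\<close> is asked entrywise, which covers a fixed matrix as
  well as a random one.\<close>

lemma measurable_transition_density:
  assumes H: "\<And>k l. k < nr \<Longrightarrow> l < nt \<Longrightarrow> (\<lambda>\<omega>. H \<omega> (k, l)) \<in> borel_measurable M"
    and x: "x \<in> M \<rightarrow>\<^sub>M cvec nt" and y: "y \<in> M \<rightarrow>\<^sub>M cvec nr"
  shows "(\<lambda>\<omega>. transition_density nt nr (H \<omega>) (x \<omega>) (y \<omega>)) \<in> borel_measurable M"
proof -
  have "(\<lambda>\<omega>. cn01_density (y \<omega> k - (\<Sum>l<nt. H \<omega> (k, l) * x \<omega> l))) \<in> borel_measurable M" if "k < nr" for k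
    using that
    by (intro measurable_compose[OF _ cn01_density_measurable] borel_measurable_diff
        borel_measurable_sum borel_measurable_times H measurable_cvec_component[OF x]
        measurable_cvec_component[OF y]) auto
  then show ?thesis
    unfolding transition_density_def noise_density_def by (intro borel_measurable_prod) auto
qed

lemma transition_density_pos: "0 < transition_density nt nr H x y"
  by (simp add: transition_density_def noise_density_pos)

lemma transition_density_le_1: "transition_density nt nr H x y \<le> 1"
  by (simp add: transition_density_def noise_density_le_1)

text \<open>Values in (0, 1] are integrable under a probability law, so the Bochner integral is the
  true marginal density and not a default value.\<close>

lemma ennreal_output_density:
  assumes "prob_space \<mu>" and sets: "sets \<mu> = sets (cvec nt)" and y: "y \<in> space (cvec nr)"
  shows "ennreal (output_density nt nr \<mu> H y) = (\<integral>\<^sup>+x. ennreal (transition_density nt nr H x y) \<partial>\<mu>)"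
proof -
  interpret prob_space \<mu> by fact
  have "(\<lambda>x. transition_density nt nr H x y) \<in> borel_measurable \<mu>"
    using y by (intro measurable_transition_density measurable_ident_sets sets) auto
  then have "integrable \<mu> (\<lambda>x. transition_density nt nr H x y)"
    by (intro integrable_const_bound[of _ 1])
       (auto simp: transition_density_le_1 transition_density_pos less_imp_le)
  then show ?thesis
    unfolding output_density_def
    by (intro nn_integral_eq_integral[symmetric]) (auto simp: transition_density_pos less_imp_le)
qed

text \<open>Given the input x, the output is noise translated by H x and has density p(y | x);
  integrating over x yields the joint law on rectangles. Taking \<open>\<mu>\<close> as its own
  reference admits laws without a Lebesgue density, such as discrete ones.\<close>

lemma distributed_received:
  assumes "prob_space \<mu>" and sets: "sets \<mu> = sets (cvec nt)"
  shows "distributed (\<mu> \<Otimes>\<^sub>M noise nr) (\<mu> \<Otimes>\<^sub>M lborel_vec nr)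
    (\<lambda>\<omega>. (fst \<omega>, case \<omega> of (x, z) \<Rightarrow> received nt nr H x z))
    (\<lambda>(x, y). ennreal (transition_density nt nr H x y))"
proof -
  interpret \<mu>: prob_space \<mu> by fact
  interpret noise: prob_space "noise nr" by (rule prob_space_noise)
  interpret L: sigma_finite_measure "lborel_vec nr" by (rule sigma_finite_lborel_vec)
  interpret P: pair_prob_space \<mu> "noise nr" ..
  have fst_meas: "fst \<in> \<mu> \<Otimes>\<^sub>M noise nr \<rightarrow>\<^sub>M cvec nt"
    using measurable_fst[of \<mu> "noise nr"] measurable_cong_sets[OF refl sets] by blast
  have snd_meas: "snd \<in> \<mu> \<Otimes>\<^sub>M noise nr \<rightarrow>\<^sub>M cvec nr"
    using measurable_snd[of \<mu> "noise nr"] measurable_cong_sets[OF refl sets_noise] by blast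
  have Y: "(\<lambda>(x, z). received nt nr H x z) \<in> \<mu> \<Otimes>\<^sub>M noise nr \<rightarrow>\<^sub>M lborel_vec nr"
    unfolding received_def lborel_vec_def case_prod_beta
    by (intro measurable_restrict)
       (auto intro!: borel_measurable_add borel_measurable_sum borel_measurable_times
        measurable_cvec_component[OF fst_meas] measurable_cvec_component[OF snd_meas])
  have f: "(\<lambda>(x, y). ennreal (transition_density nt nr H x y)) \<in> borel_measurable (\<mu> \<Otimes>\<^sub>M lborel_vec nr)"
  proof -
    have "fst \<in> \<mu> \<Otimes>\<^sub>M lborel_vec nr \<rightarrow>\<^sub>M cvec nt"
      using measurable_fst[of \<mu> "lborel_vec nr"] measurable_cong_sets[OF refl sets] by blast
    moreover have "snd \<in> \<mu> \<Otimes>\<^sub>M lborel_vec nr \<rightarrow>\<^sub>M cvec nr"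
      using measurable_snd[of \<mu> "lborel_vec nr"] measurable_cong_sets[OF refl sets_lborel_vec] by blast
    ultimately show ?thesis
      unfolding case_prod_beta
      by (intro measurable_compose[OF _ measurable_ennreal] measurable_transition_density) auto
  qed
  show ?thesis
  proof (rule P.distributed_jointI)
    fix A B assume A: "A \<in> sets \<mu>" and B: "B \<in> sets (lborel_vec nr)"
    let ?S = "{\<omega> \<in> space (\<mu> \<Otimes>\<^sub>M noise nr). fst \<omega> \<in> A \<and> (case \<omega> of (x, z) \<Rightarrow> received nt nr H x z) \<in> B}"
    have "?S \<in> sets (\<mu> \<Otimes>\<^sub>M noise nr)"
      using measurable_sets[OF measurable_fst[of \<mu> "noise nr"] A] measurable_sets[OF Y B]
      by (auto simp: vimage_def Int_def conj_ac intro: sets.Int[THEN back_subst[of "\<lambda>S. S \<in> _"]])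
    then have "emeasure (\<mu> \<Otimes>\<^sub>M noise nr) ?S = (\<integral>\<^sup>+x. emeasure (noise nr) (Pair x -` ?S) \<partial>\<mu>)"
      by (rule noise.emeasure_pair_measure_alt)
    also have "\<dots> = (\<integral>\<^sup>+x. (\<integral>\<^sup>+y. (case (x, y) of (x, y) \<Rightarrow> ennreal (transition_density nt nr H x y)) * indicator B y \<partial>lborel_vec nr) * indicator A x \<partial>\<mu>)"
    proof (rule nn_integral_cong)
      fix x assume x: "x \<in> space \<mu>"
      define c where "c k = (\<Sum>l<nt. H (k, l) * x l)" for k
      have c: "received nt nr H x = (\<lambda>z. \<lambda>k\<in>{..<nr}. c k + z k)"
        by (auto simp: received_def c_def)
      have c_meas: "(\<lambda>z. \<lambda>k\<in>{..<nr}. c k + z k) \<in> noise nr \<rightarrow>\<^sub>M cvec nr"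
        unfolding noise_def cvec_def by measurable
      have B': "B \<in> sets (cvec nr)" using B by (simp add: sets_lborel_vec)
      have T: "(\<lambda>y. ennreal (noise_density nr (\<lambda>k. y k - c k))) \<in> borel_measurable (lborel_vec nr)"
        unfolding noise_density_def lborel_vec_def by measurable
      \<comment> \<open>The slice at x is empty unless x lies in \<open>A\<close>, whence the factor
        \<open>indicator A x\<close>.\<close>
      have "emeasure (noise nr) (Pair x -` ?S)
          = emeasure (noise nr) ((\<lambda>z. \<lambda>k\<in>{..<nr}. c k + z k) -` B \<inter> space (noise nr)) * indicator A x"
        using x by (auto simp: space_pair_measure c indicator_def vimage_def Int_def conj_commute)
      also have "emeasure (noise nr) ((\<lambda>z. \<lambda>k\<in>{..<nr}. c k + z k) -` B \<inter> space (noise nr))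
          = emeasure (distr (noise nr) (cvec nr) (\<lambda>z. \<lambda>k\<in>{..<nr}. c k + z k)) B"
        by (rule emeasure_distr[OF c_meas B', symmetric])
      also have "\<dots> = (\<integral>\<^sup>+y. ennreal (noise_density nr (\<lambda>k. y k - c k)) * indicator B y \<partial>lborel_vec nr)"
        unfolding distr_translate_noise by (rule emeasure_density[OF T B])
      finally show "emeasure (noise nr) (Pair x -` ?S)
          = (\<integral>\<^sup>+y. (case (x, y) of (x, y) \<Rightarrow> ennreal (transition_density nt nr H x y)) * indicator B y \<partial>lborel_vec nr) * indicator A x"
        by (simp add: transition_density_def c_def)
    qed
    finally show "emeasure (\<mu> \<Otimes>\<^sub>M noise nr) ?S
        = (\<integral>\<^sup>+x. (\<integral>\<^sup>+y. (case (x, y) of (x, y) \<Rightarrow> ennreal (transition_density nt nr H x y)) * indicator B y \<partial>lborel_vec nr) * indicator A x \<partial>\<mu>)" .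
  qed (use Y f in \<open>auto intro: \<mu>.sigma_finite_measure_axioms L.sigma_finite_measure_axioms\<close>)
qed

text \<open>The general density formula for mutual information, applied to p(y | x) and its
  marginals: 1 for the input relative to its own law, \<open>output_density\<close> for the
  output.\<close>

lemma mimo_information_eq:
  assumes "prob_space \<mu>" and sets: "sets \<mu> = sets (cvec nt)"
  shows "mimo_information nt nr \<mu> H =
    (\<integral>(x, y). transition_density nt nr H x y *
      log 2 (transition_density nt nr H x y / output_density nt nr \<mu> H y) \<partial>(\<mu> \<Otimes>\<^sub>M lborel_vec nr))"
proof -
  interpret \<mu>: prob_space \<mu> by fact
  interpret noise: prob_space "noise nr" by (rule prob_space_noise)
  interpret L: sigma_finite_measure "lborel_vec nr" by (rule sigma_finite_lborel_vec)
  interpret P: pair_prob_space \<mu> "noise nr" ..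
  interpret P: information_space "\<mu> \<Otimes>\<^sub>M noise nr" 2 by standard simp
  let ?Y = "\<lambda>(x, z). received nt nr H x z"
  have joint: "distributed (\<mu> \<Otimes>\<^sub>M noise nr) (\<mu> \<Otimes>\<^sub>M lborel_vec nr) (\<lambda>\<omega>. (fst \<omega>, ?Y \<omega>))
      (\<lambda>xy. ennreal (case xy of (x, y) \<Rightarrow> transition_density nt nr H x y))"
    using distributed_received[OF assms, of nr H] by (simp add: case_prod_beta')
  have "distributed (\<mu> \<Otimes>\<^sub>M noise nr) (lborel_vec nr) ?Y
      (\<lambda>y. \<integral>\<^sup>+x. ennreal (case (x, y) of (x, y) \<Rightarrow> transition_density nt nr H x y) \<partial>\<mu>)"
    by (rule P.distr_marginal2[OF _ _ joint]) unfold_locales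
  moreover have "(\<integral>\<^sup>+x. ennreal (case (x, y) of (x, y) \<Rightarrow> transition_density nt nr H x y) \<partial>\<mu>)
      = ennreal (output_density nt nr \<mu> H y)" if "y \<in> space (lborel_vec nr)" for y
    using ennreal_output_density[OF assms, of y nr H] that
      sets_eq_imp_space_eq[OF sets_lborel_vec] by simp
  ultimately have out: "distributed (\<mu> \<Otimes>\<^sub>M noise nr) (lborel_vec nr) ?Y
      (\<lambda>y. ennreal (output_density nt nr \<mu> H y))"
    unfolding distributed_def
    by (auto cong: density_cong measurable_cong)
  have inp: "distributed (\<mu> \<Otimes>\<^sub>M noise nr) \<mu> fst (\<lambda>x. ennreal 1)"
    unfolding distributed_def by (simp add: noise.distr_pair_fst density_1)
  \<comment> \<open>Mutual information sees only the sigma-algebras of the target spaces, so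
    \<open>cvec\<close> may be exchanged for the reference measures \<open>\<mu>\<close> and
    \<open>lborel_vec nr\<close>.\<close>
  have "mimo_information nt nr \<mu> H
      = P.mutual_information 2 \<mu> (lborel_vec nr) fst ?Y"
    unfolding mimo_information_def P.mutual_information_def
    by (intro arg_cong2[where f = "KL_divergence 2"] arg_cong2[where f = pair_measure] distr_cong
        sets_pair_measure_cong) (auto simp: sets sets_lborel_vec)
  also have "\<dots> = (\<integral>xy. (case xy of (x, y) \<Rightarrow> transition_density nt nr H x y) *
      log 2 ((case xy of (x, y) \<Rightarrow> transition_density nt nr H x y) / (1 * output_density nt nr \<mu> H (snd xy)))
      \<partial>(\<mu> \<Otimes>\<^sub>M lborel_vec nr))"
    by (rule P.mutual_information_distr[OF _ _ inp _ out _ joint])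
       (auto simp: transition_density_pos less_imp_le output_density_def
         \<mu>.sigma_finite_measure_axioms L.sigma_finite_measure_axioms)
  finally show ?thesis by (simp add: case_prod_beta')
qed

text \<open>Integrating out some variables of a jointly measurable function leaves a measurable
  function of the others. This is used twice: over x for the output density, then over (x, y) for
  the whole integrand.\<close>

lemma measurable_mimo_information:
  assumes "prob_space \<mu>" and sets: "sets \<mu> = sets (cvec nt)"
  shows "mimo_information nt nr \<mu> \<in> borel_measurable (rayleigh nt nr)"
proof -
  interpret \<mu>: prob_space \<mu> by fact
  interpret L: sigma_finite_measure "lborel_vec nr" by (rule sigma_finite_lborel_vec)
  interpret P: pair_sigma_finite \<mu> "lborel_vec nr" ..
  let ?R = "rayleigh nt nr"
  have idx: "x \<in> M \<rightarrow>\<^sub>M \<mu> \<Longrightarrow> x \<in> M \<rightarrow>\<^sub>M cvec nt" for x and M :: "'z measure"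
    using measurable_cong_sets[OF refl sets] by blast
  have idy: "y \<in> M \<rightarrow>\<^sub>M lborel_vec nr \<Longrightarrow> y \<in> M \<rightarrow>\<^sub>M cvec nr" for y and M :: "'z measure"
    using measurable_cong_sets[OF refl sets_lborel_vec] by blast
  have t: "(\<lambda>\<omega>. transition_density nt nr (fst \<omega>) (fst (snd \<omega>)) (snd (snd \<omega>)))
      \<in> borel_measurable (?R \<Otimes>\<^sub>M (\<mu> \<Otimes>\<^sub>M lborel_vec nr))"
    by (intro measurable_transition_density measurable_rayleigh_component idx idy) measurable
  \<comment> \<open>Here x comes last, as the variable to be integrated out with H and y as
    parameters.\<close>
  have "(\<lambda>(Hy, x). transition_density nt nr (fst Hy) x (snd Hy))
      \<in> borel_measurable ((?R \<Otimes>\<^sub>M lborel_vec nr) \<Otimes>\<^sub>M \<mu>)"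
    unfolding case_prod_beta
    by (intro measurable_transition_density measurable_rayleigh_component idx idy) measurable
  then have out: "(\<lambda>Hy. output_density nt nr \<mu> (fst Hy) (snd Hy)) \<in> borel_measurable (?R \<Otimes>\<^sub>M lborel_vec nr)"
    unfolding output_density_def by (rule \<mu>.borel_measurable_lebesgue_integral)
  have o: "(\<lambda>\<omega>. output_density nt nr \<mu> (fst \<omega>) (snd (snd \<omega>)))
      \<in> borel_measurable (?R \<Otimes>\<^sub>M (\<mu> \<Otimes>\<^sub>M lborel_vec nr))"
  proof -
    have "(\<lambda>\<omega>. (fst \<omega>, snd (snd \<omega>))) \<in> ?R \<Otimes>\<^sub>M (\<mu> \<Otimes>\<^sub>M lborel_vec nr) \<rightarrow>\<^sub>M ?R \<Otimes>\<^sub>M lborel_vec nr"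
      by measurable
    from measurable_compose[OF this out] show ?thesis by simp
  qed
  have "(\<lambda>(H, xy). case xy of (x, y) \<Rightarrow> transition_density nt nr H x y *
      log 2 (transition_density nt nr H x y / output_density nt nr \<mu> H y))
      \<in> borel_measurable (?R \<Otimes>\<^sub>M (\<mu> \<Otimes>\<^sub>M lborel_vec nr))"
    unfolding case_prod_beta
    by (intro borel_measurable_times borel_measurable_log borel_measurable_divide t o
        borel_measurable_const)
  then have "(\<lambda>H. \<integral>xy. (case xy of (x, y) \<Rightarrow> transition_density nt nr H x y *
      log 2 (transition_density nt nr H x y / output_density nt nr \<mu> H y)) \<partial>(\<mu> \<Otimes>\<^sub>M lborel_vec nr))
      \<in> borel_measurable ?R"
    by (rule P.borel_measurable_lebesgue_integral)
  then show ?thesis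
    unfolding mimo_information_eq[OF assms, abs_def] .
qed


section \<open>Outage probabilities of a single hop\<close>

definition hop_outage_prob ::
  "nat \<Rightarrow> nat \<Rightarrow> (nat \<Rightarrow> complex) measure \<Rightarrow> real \<Rightarrow> real" where
  "hop_outage_prob nt nr \<mu> R =
     measure (rayleigh nt nr) {H \<in> space (rayleigh nt nr). channel_outage nt nr \<mu> H R}"

lemma p2p_outage_prob_eq:
  "p2p_outage_prob nt nr SNR R = (INF \<mu>\<in>input_laws nt SNR. hop_outage_prob nt nr \<mu> R)"
  by (simp add: p2p_outage_prob_def hop_outage_prob_def)

lemma sets_channel_outage:
  assumes "\<mu> \<in> input_laws nt SNR"
  shows "{H \<in> space (rayleigh nt nr). channel_outage nt nr \<mu> H R} \<in> sets (rayleigh nt nr)"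
proof -
  have [measurable]: "mimo_information nt nr \<mu> \<in> borel_measurable (rayleigh nt nr)"
    using assms by (intro measurable_mimo_information) (auto simp: input_laws_def)
  show ?thesis unfolding channel_outage_def by measurable
qed

text \<open>The silent transmitter has power 0 and is admissible at every SNR, even a negative one,
  which \<open>ennreal\<close> sends to 0. Nonemptiness makes the real-valued infima over input laws
  meaningful.\<close>

lemma input_laws_nonempty: "input_laws nt SNR \<noteq> {}"
proof -
  let ?\<mu> = "return (cvec nt) (\<lambda>l\<in>{..<nt}. 0)"
  have sp: "(\<lambda>l\<in>{..<nt}. 0) \<in> space (cvec nt)"
    by (simp add: cvec_def space_PiM)
  have "(\<lambda>x. ennreal (\<Sum>l<nt. (cmod (x l))\<^sup>2)) \<in> borel_measurable (cvec nt)"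
    unfolding cvec_def by measurable
  then have "(\<integral>\<^sup>+x. ennreal (\<Sum>l<nt. (cmod (x l))\<^sup>2) \<partial>?\<mu>) = 0"
    using sp by (simp add: nn_integral_return)
  then have "?\<mu> \<in> input_laws nt SNR"
    using prob_space_return[OF sp] by (simp add: input_laws_def)
  then show ?thesis by blast
qed

lemma bdd_below_measure: "bdd_below ((\<lambda>x. measure M (A x)) ` S)"
  by (rule bdd_belowI2[of _ 0]) simp

lemma p2p_outage_prob_le:
  assumes "\<mu> \<in> input_laws nt SNR"
  shows "p2p_outage_prob nt nr SNR R \<le> hop_outage_prob nt nr \<mu> R"
  unfolding p2p_outage_prob_eq using assms
  by (intro cINF_lower) (simp_all add: hop_outage_prob_def bdd_below_measure)

lemma p2p_outage_prob_nonneg: "0 \<le> p2p_outage_prob nt nr SNR R"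
  unfolding p2p_outage_prob_eq
  by (intro cINF_greatest input_laws_nonempty) (simp add: hop_outage_prob_def)

section \<open>Comparison of the multihop channel with its hops\<close>

lemma prob_space_multihop: "prob_space (multihop n N)"
  unfolding multihop_def by (intro prob_space_PiM prob_space_rayleigh)

lemma multihop_component:
  assumes "i \<in> {1..N}"
  shows "(\<lambda>H. H i) \<in> multihop n N \<rightarrow>\<^sub>M rayleigh (n (i - 1)) (n i)"
  unfolding multihop_def using assms by (rule measurable_component_singleton)

lemma measure_multihop_component:
  assumes i: "i \<in> {1..N}" and A: "A \<in> sets (rayleigh (n (i - 1)) (n i))"
  shows "measure (multihop n N) {H \<in> space (multihop n N). H i \<in> A}
    = measure (rayleigh (n (i - 1)) (n i)) A"
proof -
  have "distr (multihop n N) (rayleigh (n (i - 1)) (n i)) (\<lambda>H. H i) = rayleigh (n (i - 1)) (n i)"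
    unfolding multihop_def using i by (intro distr_PiM_component prob_space_rayleigh)
  then have "measure (rayleigh (n (i - 1)) (n i)) A
      = measure (distr (multihop n N) (rayleigh (n (i - 1)) (n i)) (\<lambda>H. H i)) A"
    by simp
  also have "\<dots> = measure (multihop n N) ((\<lambda>H. H i) -` A \<inter> space (multihop n N))"
    by (rule measure_distr[OF multihop_component[OF i] A])
  finally show ?thesis by (simp add: vimage_def Int_def conj_commute)
qed

text \<open>Unrolling the recursion turns failure of the chain into a union of events, each about a
  single hop.\<close>

lemma df_decodes_iff:
  "df_decodes n X H R m \<longleftrightarrow> (\<forall>i\<in>{1..m}. \<not> channel_outage (n (i - 1)) (n i) (X (i - 1)) (H i) R)"
proof (induction m)
  case (Suc m)
  have "{1..Suc m} = insert (Suc m) {1..m}" by auto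
  then show ?case using Suc by auto
qed simp

definition hop_outage_event where
  "hop_outage_event n N X R i =
    {H \<in> space (multihop n N). channel_outage (n (i - 1)) (n i) (X (i - 1)) (H i) R}"

text \<open>The event constrains only coordinate \<open>i\<close>, whose marginal under the product
  law is the Rayleigh law of that hop.\<close>

lemma hop_outage_event:
  assumes X: "X \<in> (\<Pi> i\<in>{..<N}. input_laws (n i) SNR)" and i: "i \<in> {1..N}"
  shows sets_hop_outage_event: "hop_outage_event n N X R i \<in> sets (multihop n N)"
    and measure_hop_outage_event: "measure (multihop n N) (hop_outage_event n N X R i)
      = hop_outage_prob (n (i - 1)) (n i) (X (i - 1)) R"
proof -
  let ?A = "{H \<in> space (rayleigh (n (i - 1)) (n i)).
    channel_outage (n (i - 1)) (n i) (X (i - 1)) H R}"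
  have "i - 1 \<in> {..<N}" using i by auto
  then have A: "?A \<in> sets (rayleigh (n (i - 1)) (n i))"
    using X by (intro sets_channel_outage) auto
  have eq: "hop_outage_event n N X R i = {H \<in> space (multihop n N). H i \<in> ?A}"
    unfolding hop_outage_event_def using measurable_space[OF multihop_component[OF i]] by auto
  then have "hop_outage_event n N X R i = (\<lambda>H. H i) -` ?A \<inter> space (multihop n N)"
    by auto
  then show "hop_outage_event n N X R i \<in> sets (multihop n N)"
    using measurable_sets[OF multihop_component[OF i] A] by simp
  show "measure (multihop n N) (hop_outage_event n N X R i)
      = hop_outage_prob (n (i - 1)) (n i) (X (i - 1)) R"
    unfolding eq hop_outage_prob_def by (rule measure_multihop_component[OF i A])
qed

section \<open>Decode-and-forward between the maximum and the sum of its hops\<close>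

lemma df_outage_event:
  "{H \<in> space (multihop n N). \<not> df_decodes n X H R N} = (\<Union>i\<in>{1..N}. hop_outage_event n N X R i)"
  by (auto simp: df_decodes_iff hop_outage_event_def)

text \<open>Whatever laws the layers use, failure contains the outage of hop \<open>i\<close>, and
  the law used there is one competitor in the point-to-point infimum.\<close>

lemma p2p_outage_prob_le_df:
  assumes i: "i \<in> {1..N}"
  shows "p2p_outage_prob (n (i - 1)) (n i) SNR R \<le> df_outage_prob n N SNR R"
  unfolding df_outage_prob_def
proof (rule cINF_greatest)
  show "(\<Pi> i\<in>{..<N}. input_laws (n i) SNR) \<noteq> {}"
    using input_laws_nonempty by (simp add: Pi_eq_empty)
next
  fix X assume X: "X \<in> (\<Pi> i\<in>{..<N}. input_laws (n i) SNR)"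
  interpret prob_space "multihop n N" by (rule prob_space_multihop)
  have "p2p_outage_prob (n (i - 1)) (n i) SNR R \<le> hop_outage_prob (n (i - 1)) (n i) (X (i - 1)) R"
    using X i by (intro p2p_outage_prob_le) auto
  also have "\<dots> = prob (hop_outage_event n N X R i)"
    by (rule measure_hop_outage_event[OF X i, symmetric])
  also have "\<dots> \<le> prob (\<Union>i\<in>{1..N}. hop_outage_event n N X R i)"
    using i sets_hop_outage_event[OF X]
    by (intro finite_measure_mono sets.finite_UN) auto
  finally show "p2p_outage_prob (n (i - 1)) (n i) SNR R
      \<le> prob {H \<in> space (multihop n N). \<not> df_decodes n X H R N}"
    unfolding df_outage_event .
qed

text \<open>Union bound over the hops, with the law of each layer chosen separately. The infima need
  not be attained, hence near-optimal laws and an arbitrary slack \<open>e\<close>.\<close>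

lemma df_outage_prob_le_sum:
  "df_outage_prob n N SNR R \<le> (\<Sum>i\<in>{1..N}. p2p_outage_prob (n (i - 1)) (n i) SNR R)"
proof (rule field_le_epsilon)
  fix e :: real assume e: "0 < e"
  \<comment> \<open>The slack is shared by the \<open>N\<close> hops; \<open>N + 1\<close> also
    avoids division by zero when \<open>N\<close> is 0.\<close>
  define \<epsilon> where "\<epsilon> = e / (real N + 1)"
  have \<epsilon>: "0 < \<epsilon>" "real N * \<epsilon> \<le> e"
    using e by (auto simp: \<epsilon>_def field_simps)
  \<comment> \<open>Laws are indexed by the transmitting layer, so layer \<open>i\<close> feeds hop
    \<open>Suc i\<close>. One is picked for every \<open>i\<close>, to obtain a total function
    \<open>X\<close>.\<close>
  have "\<exists>\<mu>\<in>input_laws (n i) SNR. hop_outage_prob (n i) (n (Suc i)) \<mu> R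
      < p2p_outage_prob (n i) (n (Suc i)) SNR R + \<epsilon>" for i
    unfolding p2p_outage_prob_eq using \<epsilon>
    by (subst cINF_less_iff[symmetric])
       (auto simp: input_laws_nonempty hop_outage_prob_def bdd_below_measure)
  then obtain X where X: "\<And>i. X i \<in> input_laws (n i) SNR"
    "\<And>i. hop_outage_prob (n i) (n (Suc i)) (X i) R < p2p_outage_prob (n i) (n (Suc i)) SNR R + \<epsilon>"
    by metis
  have XPi: "X \<in> (\<Pi> i\<in>{..<N}. input_laws (n i) SNR)" using X by auto
  interpret prob_space "multihop n N" by (rule prob_space_multihop)
  have "df_outage_prob n N SNR R \<le> prob {H \<in> space (multihop n N). \<not> df_decodes n X H R N}"
    unfolding df_outage_prob_def by (rule cINF_lower[OF bdd_below_measure XPi])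
  also have "\<dots> \<le> (\<Sum>i\<in>{1..N}. prob (hop_outage_event n N X R i))"
    unfolding df_outage_event using sets_hop_outage_event[OF XPi]
    by (intro finite_measure_subadditive_finite) auto
  also have "\<dots> \<le> (\<Sum>i\<in>{1..N}. p2p_outage_prob (n (i - 1)) (n i) SNR R + \<epsilon>)"
  proof (rule sum_mono)
    fix i assume i: "i \<in> {1..N}"
    then show "prob (hop_outage_event n N X R i) \<le> p2p_outage_prob (n (i - 1)) (n i) SNR R + \<epsilon>"
      unfolding measure_hop_outage_event[OF XPi i] using X(2)[of "i - 1"] by simp
  qed
  also have "\<dots> \<le> (\<Sum>i\<in>{1..N}. p2p_outage_prob (n (i - 1)) (n i) SNR R) + e"
    using \<epsilon> by (simp add: sum.distrib)
  finally show "df_outage_prob n N SNR R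
      \<le> (\<Sum>i\<in>{1..N}. p2p_outage_prob (n (i - 1)) (n i) SNR R) + e" .
qed

text \<open>Given all hops but hop \<open>i\<close>, the input of hop \<open>i\<close> has a law that by causality does not depend
  on \<open>H i\<close>; hence the conditional outage probability is at least the point-to-point one.\<close>

lemma p2p_outage_prob_le_strategy:
  assumes strat: "relaying_strategy n N SNR X J" and i: "i \<in> {1..N}"
  shows "p2p_outage_prob (n (i - 1)) (n i) SNR R \<le> strategy_outage_prob n N J R"
proof -
  define M where "M j = rayleigh (n (j - 1)) (n j)" for j
  define I where "I = {1..N} - {i}"
  define S where "S = {H \<in> space (multihop n N). J H < R}"
  define p where "p = p2p_outage_prob (n (i - 1)) (n i) SNR R"
  have I: "finite I" "i \<notin> I" "insert i I = {1..N}" using i by (auto simp: I_def)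
  have mh: "multihop n N = PiM (insert i I) M"
    unfolding I multihop_def M_def ..
  interpret M: product_prob_space M
    unfolding M_def by (intro product_prob_spaceI prob_space_rayleigh)
  interpret PI: prob_space "PiM I M" by (intro prob_space_PiM M.prob_space)
  interpret mh: prob_space "multihop n N" by (rule prob_space_multihop)
  have "J \<in> borel_measurable (multihop n N)"
    using strat by (simp add: relaying_strategy_def)
  then have S: "S \<in> sets (multihop n N)" unfolding S_def by measurable
  have "ennreal p \<le> (\<integral>\<^sup>+y. indicator S (h(i := y)) \<partial>M i)" if h: "h \<in> space (PiM I M)" for h
  proof -
    \<comment> \<open>An arbitrary value for hop \<open>i\<close> completes \<open>h\<close> to a
      realization at which the input law can be read off.\<close>
    obtain y0 where y0: "y0 \<in> space (M i)" using M.M.not_empty[of i] by blast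
    have upd: "h(i := y) \<in> space (multihop n N)" if "y \<in> space (M i)" for y
      using h that unfolding mh space_PiM by (intro PiE_fun_upd)
    define \<mu> where "\<mu> = X (i - 1) (h(i := y0))"
    \<comment> \<open>Layer \<open>i - 1\<close> exploits only hops 1 to \<open>i - 1\<close>, so
      changing hop \<open>i\<close> leaves its law unchanged.\<close>
    have causal: "X (i - 1) (h(i := y)) = \<mu>" if "y \<in> space (M i)" for y
    proof -
      have "\<forall>j\<in>{1..i - 1}. (h(i := y)) j = (h(i := y0)) j" using i by auto
      moreover have "i - 1 < N" using i by auto
      ultimately show ?thesis
        using strat upd[OF that] upd[OF y0] unfolding relaying_strategy_def \<mu>_def by blast
    qed
    have "i - 1 < N" using i by auto
    then have \<mu>: "\<mu> \<in> input_laws (n (i - 1)) SNR"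
      using strat upd[OF y0] unfolding relaying_strategy_def \<mu>_def by blast
    let ?A = "{y \<in> space (M i). channel_outage (n (i - 1)) (n i) \<mu> y R}"
    have A: "?A \<in> sets (M i)"
      unfolding M_def by (rule sets_channel_outage[OF \<mu>])
    \<comment> \<open>By the cut-set inequality at hop \<open>i\<close>, an outage there forces the
      end-to-end information below \<open>R\<close>.\<close>
    have "h(i := y) \<in> S" if "y \<in> ?A" for y
    proof -
      from that have y: "y \<in> space (M i)" and "mimo_information (n (i - 1)) (n i) \<mu> y < R"
        by (auto simp: channel_outage_def)
      moreover have "J (h(i := y)) \<le> mimo_information (n (i - 1)) (n i) (X (i - 1) (h(i := y))) ((h(i := y)) i)"
        using strat upd[OF y] i unfolding relaying_strategy_def by blast
      ultimately show ?thesis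
        using upd[OF y] causal[OF y] by (simp add: S_def)
    qed
    then have "(\<integral>\<^sup>+y. indicator ?A y \<partial>M i) \<le> (\<integral>\<^sup>+y. indicator S (h(i := y)) \<partial>M i)"
      by (intro nn_integral_mono) (auto simp: indicator_def)
    moreover have "p \<le> measure (M i) ?A"
      using p2p_outage_prob_le[OF \<mu>] by (simp add: p_def hop_outage_prob_def M_def)
    then have "ennreal p \<le> emeasure (M i) ?A"
      by (simp add: M.M.emeasure_eq_measure ennreal_leI)
    ultimately show ?thesis
      using A by simp
  qed
  then have "(\<integral>\<^sup>+h. ennreal p \<partial>PiM I M) \<le> (\<integral>\<^sup>+h. (\<integral>\<^sup>+y. indicator S (h(i := y)) \<partial>M i) \<partial>PiM I M)"
    by (intro nn_integral_mono)
  \<comment> \<open>Independence of the hops enters here: by Fubini the iterated integral is the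
    probability of \<open>S\<close>.\<close>
  also have "\<dots> = (\<integral>\<^sup>+H. indicator S H \<partial>PiM (insert i I) M)"
    using I S by (intro M.product_nn_integral_insert[symmetric]) (auto simp: mh)
  also have "\<dots> = ennreal (measure (multihop n N) S)"
    using S by (simp add: mh[symmetric] mh.emeasure_eq_measure)
  finally have "ennreal p \<le> ennreal (measure (multihop n N) S)"
    by (simp add: PI.emeasure_space_1)
  then show ?thesis
    by (simp add: p_def strategy_outage_prob_def S_def)
qed

section \<open>Exponents\<close>

text \<open>\<open>1 < SNR\<close> makes \<open>log 2 SNR\<close> positive. Monotonicity extends to
  \<open>p = 0\<close> because the exponent is infinite there.\<close>

lemma outage_exponent_antimono:
  assumes "1 < SNR" "0 \<le> p" "p \<le> q"
  shows "outage_exponent q SNR \<le> outage_exponent p SNR"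
  using assms by (auto simp: outage_exponent_def divide_right_mono)

text \<open>A constant factor shifts the exponent by a finite term that vanishes as SNR grows; at
  \<open>p = 0\<close> both sides are infinite.\<close>

lemma outage_exponent_mult:
  assumes "1 < SNR" "0 < c" "0 \<le> p"
  shows "outage_exponent (c * p) SNR = outage_exponent p SNR + ereal (- (log 2 c / log 2 SNR))"
  using assms by (auto simp: outage_exponent_def log_mult diff_divide_distrib)

lemma tendsto_Min:
  fixes f :: "'i \<Rightarrow> 'b \<Rightarrow> 'a::linorder_topology"
  assumes "finite I" "I \<noteq> {}" "\<And>i. i \<in> I \<Longrightarrow> (f i \<longlongrightarrow> l i) F"
  shows "((\<lambda>x. MIN i\<in>I. f i x) \<longlongrightarrow> (MIN i\<in>I. l i)) F"
  using assms
proof (induction I rule: finite_ne_induct)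
  case (insert i I)
  then show ?case by (auto intro!: tendsto_min simp: Min_insert)
qed simp

text \<open>\<open>P\<close> lies between the largest \<open>p i\<close> and \<open>card I\<close>
  times it. Its exponent is thus squeezed between the minimal exponent and that minimum plus the
  correction from the factor \<open>card I\<close>, which tends to 0.\<close>

lemma tendsto_outage_exponent_max:
  fixes p :: "'i \<Rightarrow> real \<Rightarrow> real"
  assumes I: "finite I" "I \<noteq> {}"
    and lim: "\<And>i. i \<in> I \<Longrightarrow> ((\<lambda>SNR. outage_exponent (p i SNR) SNR) \<longlongrightarrow> l i) at_top"
    and nonneg: "\<And>i SNR. i \<in> I \<Longrightarrow> 0 \<le> p i SNR"
    and lower: "\<And>i SNR. i \<in> I \<Longrightarrow> p i SNR \<le> P SNR"
    and upper: "\<And>SNR. P SNR \<le> (\<Sum>i\<in>I. p i SNR)"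
  shows "((\<lambda>SNR. outage_exponent (P SNR) SNR) \<longlongrightarrow> (MIN i\<in>I. l i)) at_top"
proof -
  let ?m = "\<lambda>SNR. MIN i\<in>I. outage_exponent (p i SNR) SNR"
  let ?c = "\<lambda>SNR. ereal (- (log 2 (card I) / log 2 SNR))"
  have m: "(?m \<longlongrightarrow> (MIN i\<in>I. l i)) at_top"
    using I lim by (rule tendsto_Min)
  have "((\<lambda>SNR. - (c / log 2 SNR)) \<longlongrightarrow> 0) at_top" for c :: real
    by real_asymp
  then have "(?c \<longlongrightarrow> ereal 0) at_top" by (rule tendsto_ereal)
  \<comment> \<open>One summand has a real limit, so the sum converges even when the minimum is
    infinite.\<close>
  then have "((\<lambda>SNR. ?m SNR + ?c SNR) \<longlongrightarrow> (MIN i\<in>I. l i) + ereal 0) at_top"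
    using m by (intro tendsto_add_ereal_general) auto
  then have mc: "((\<lambda>SNR. ?m SNR + ?c SNR) \<longlongrightarrow> (MIN i\<in>I. l i)) at_top"
    by (simp add: zero_ereal_def[symmetric])
  have le_m: "\<forall>\<^sub>F SNR in at_top. outage_exponent (P SNR) SNR \<le> ?m SNR"
    using eventually_gt_at_top[of 1]
  proof eventually_elim
    case (elim SNR)
    then show ?case
      using I nonneg lower by (subst Min_ge_iff) (auto intro: outage_exponent_antimono)
  qed
  have ge_m: "\<forall>\<^sub>F SNR in at_top. ?m SNR + ?c SNR \<le> outage_exponent (P SNR) SNR"
    using eventually_gt_at_top[of 1]
  proof eventually_elim
    case (elim SNR)
    \<comment> \<open>The dominant index may change with SNR, which is harmless because the bound is
      pointwise.\<close>
    obtain j where j: "j \<in> I" "\<And>i. i \<in> I \<Longrightarrow> p i SNR \<le> p j SNR"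
    proof -
      have "Max ((\<lambda>i. p i SNR) ` I) \<in> (\<lambda>i. p i SNR) ` I" using I by (intro Max_in) auto
      then obtain j where "j \<in> I" "p j SNR = Max ((\<lambda>i. p i SNR) ` I)" by force
      then show ?thesis using I that by (metis Max_ge finite_imageI imageI)
    qed
    have "P SNR \<le> card I * p j SNR"
      using upper[of SNR] sum_bounded_above[of I "\<lambda>i. p i SNR" "p j SNR"] j(2) by simp
    moreover have "0 \<le> P SNR" using nonneg[OF j(1)] lower[OF j(1)] by (rule order_trans)
    ultimately have "outage_exponent (card I * p j SNR) SNR \<le> outage_exponent (P SNR) SNR"
      using elim by (intro outage_exponent_antimono)
    moreover have "outage_exponent (card I * p j SNR) SNR = outage_exponent (p j SNR) SNR + ?c SNR"
      using elim nonneg[OF j(1)] I by (intro outage_exponent_mult) (auto simp: card_gt_0_iff)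
    moreover have "?m SNR \<le> outage_exponent (p j SNR) SNR"
      using I j by (intro Min_le) auto
    ultimately show ?case
      using add_right_mono[of "?m SNR" "outage_exponent (p j SNR) SNR" "?c SNR"] by simp
  qed
  show ?thesis by (rule tendsto_sandwich[OF ge_m le_m mc m])
qed

text \<open>Both clauses of \<^const>\<open>has_dmt\<close> concern the outage probability at a rate that is a function
  of the SNR.\<close>

definition dmt_rates :: "real \<Rightarrow> (real \<Rightarrow> real) set" where
  "dmt_rates r = (if r = 0 then {\<lambda>_. R |R. R > 0} else {\<lambda>SNR. r * log 2 SNR})"

lemma has_dmt_iff:
  "has_dmt Pout r d \<longleftrightarrow>
    (\<forall>\<rho>\<in>dmt_rates r. ((\<lambda>SNR. outage_exponent (Pout SNR (\<rho> SNR)) SNR) \<longlongrightarrow> d) at_top)"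
  by (auto simp: has_dmt_def dmt_rates_def)

lemma dmt_rates_nonempty: "dmt_rates r \<noteq> {}"
  by (auto simp: dmt_rates_def intro: exI[of _ 1])

text \<open>Strategies are compared only at positive rates, so the rate must be positive along the
  limit.\<close>

lemma dmt_rates_pos: "\<rho> \<in> dmt_rates r \<Longrightarrow> 0 \<le> r \<Longrightarrow> 1 < SNR \<Longrightarrow> 0 < \<rho> SNR"
  by (auto simp: dmt_rates_def split: if_splits)

text \<open>Larger outage probabilities have smaller exponents, and limits preserve this order. Each
  tradeoff value is the limit along every admissible rate, so comparing along one of them is
  enough.\<close>

lemma has_dmt_antimono:
  assumes "has_dmt P r d" "has_dmt Q r d'" "0 \<le> r"
    and nonneg: "\<And>SNR R. 0 \<le> P SNR R"
    and le: "\<And>SNR R. 0 < SNR \<Longrightarrow> 0 < R \<Longrightarrow> P SNR R \<le> Q SNR R"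
  shows "d' \<le> d"
proof -
  obtain \<rho> where \<rho>: "\<rho> \<in> dmt_rates r" using dmt_rates_nonempty by blast
  have "((\<lambda>SNR. outage_exponent (P SNR (\<rho> SNR)) SNR) \<longlongrightarrow> d) at_top"
    "((\<lambda>SNR. outage_exponent (Q SNR (\<rho> SNR)) SNR) \<longlongrightarrow> d') at_top"
    using assms \<rho> by (auto simp: has_dmt_iff)
  moreover have "\<forall>\<^sub>F SNR in at_top. outage_exponent (Q SNR (\<rho> SNR)) SNR \<le> outage_exponent (P SNR (\<rho> SNR)) SNR"
    using eventually_gt_at_top[of 1]
  proof eventually_elim
    case (elim SNR)
    then show ?case
      using dmt_rates_pos[OF \<rho> \<open>0 \<le> r\<close> elim]
      by (intro outage_exponent_antimono nonneg le) auto
  qed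
  ultimately show ?thesis
    by (intro tendsto_le[OF trivial_limit_at_top_linorder])
qed

section \<open>Achievability and the converse\<close>

theorem mainTheorem2:
  fixes N :: nat and n :: "nat \<Rightarrow> nat" and r :: real and d :: "nat \<Rightarrow> real \<Rightarrow> ereal"
  assumes "N \<ge> 1"
    and "\<And>i. i \<le> N \<Longrightarrow> n i \<ge> 1"
    and "r \<ge> 0"
    and "\<And>i. i \<in> {1..N} \<Longrightarrow> has_dmt (p2p_outage_prob (n (i - 1)) (n i)) r (d i r)"
  shows "has_dmt (df_outage_prob n N) r (MIN i\<in>{1..N}. d i r) \<and>
    (\<forall>X J d'.
       (\<forall>SNR>0. \<forall>R>0. relaying_strategy n N SNR (X SNR R) (J SNR R)) \<longrightarrow>
       has_dmt (\<lambda>SNR R. strategy_outage_prob n N (J SNR R) R) r d' \<longrightarrow>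
       d' \<le> (MIN i\<in>{1..N}. d i r))"
proof (intro conjI allI impI)
  show "has_dmt (df_outage_prob n N) r (MIN i\<in>{1..N}. d i r)"
    unfolding has_dmt_iff
  proof
    fix \<rho> assume \<rho>: "\<rho> \<in> dmt_rates r"
    show "((\<lambda>SNR. outage_exponent (df_outage_prob n N SNR (\<rho> SNR)) SNR)
        \<longlongrightarrow> (MIN i\<in>{1..N}. d i r)) at_top"
    proof (rule tendsto_outage_exponent_max)
      fix i assume "i \<in> {1..N}"
      then show "((\<lambda>SNR. outage_exponent (p2p_outage_prob (n (i - 1)) (n i) SNR (\<rho> SNR)) SNR)
          \<longlongrightarrow> d i r) at_top"
        using assms(4) \<rho> by (auto simp: has_dmt_iff)
    next
      fix i SNR assume i: "i \<in> {1..N}"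
      show "0 \<le> p2p_outage_prob (n (i - 1)) (n i) SNR (\<rho> SNR)"
        by (rule p2p_outage_prob_nonneg)
      show "p2p_outage_prob (n (i - 1)) (n i) SNR (\<rho> SNR) \<le> df_outage_prob n N SNR (\<rho> SNR)"
        using i by (rule p2p_outage_prob_le_df)
    next
      fix SNR
      show "df_outage_prob n N SNR (\<rho> SNR)
          \<le> (\<Sum>i\<in>{1..N}. p2p_outage_prob (n (i - 1)) (n i) SNR (\<rho> SNR))"
        by (rule df_outage_prob_le_sum)
    qed (use assms(1) in auto)
  qed
next
  fix X J d'
  assume strat: "\<forall>SNR>0. \<forall>R>0. relaying_strategy n N SNR (X SNR R) (J SNR R)"
    and dmt: "has_dmt (\<lambda>SNR R. strategy_outage_prob n N (J SNR R) R) r d'"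
  \<comment> \<open>The converse is proved hop by hop; \<open>N \<ge> 1\<close> then makes the
    minimum range over a nonempty set.\<close>
  have "d' \<le> d i r" if "i \<in> {1..N}" for i
    using assms(4)[OF that] dmt assms(3) p2p_outage_prob_nonneg
  proof (rule has_dmt_antimono)
    fix SNR R :: real assume "0 < SNR" "0 < R"
    then show "p2p_outage_prob (n (i - 1)) (n i) SNR R \<le> strategy_outage_prob n N (J SNR R) R"
      using strat that by (intro p2p_outage_prob_le_strategy) auto
  qed
  then show "d' \<le> (MIN i\<in>{1..N}. d i r)"
    using assms(1) by (subst Min_ge_iff) auto
qed

end
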